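(* Let $D$ be a ring with one, let $c\geq 3$, let $L_0,L_1,\ldots,L_c$ be left $D$-modules, and let $\eta^{L_i}_{L_{i+1}}\in\mathrm{Ext}^1_D(L_i,L_{i+1})$ for $i=0,\ldots,c-1$. If $\mathrm{ExtMod}(\eta^{L_0}_{L_1},\ldots,\eta^{L_{c-1}}_{L_c})\neq\emptyset$, then the Yoneda products $\eta^{L_{i-1}}_{L_i}\circ\eta^{L_i}_{L_{i+1}}\in\mathrm{Ext}^2_D(L_{i-1},L_{i+1})$ vanish for all $i=1,\ldots,c-1$.
   Context: All modules are left $D$-modules. Elements of $\mathrm{Ext}^1_D(A,B)$ are identified (Yoneda) with congruence classes of short exact sequences $0\leftarrow A\leftarrow G\leftarrow B\leftarrow 0$. Yoneda products are written from left to right: for $\eta\in\mathrm{Ext}^1_D(A,B)$ represented by $0\leftarrow A\leftarrow G\leftarrow B\leftarrow 0$ and $\eta'\in\mathrm{Ext}^1_D(B,C)$ represented by $0\leftarrow B\leftarrow G'\leftarrow C\leftarrow 0$, $\eta\circ\eta'\in\mathrm{Ext}^2_D(A,C)$ is the class of the spliced exact sequence $0\leftarrow A\leftarrow G\leftarrow G'\leftarrow C\leftarrow 0$. A $c$-extension module is a module $E$ together with a chain of submodules $E=E_0\geq E_1\geq\cdots\geq E_c\geq E_{c+1}=0$. $\mathrm{ExtMod}(\eta^{L_0}_{L_1},\ldots,\eta^{L_{c-1}}_{L_c})$ denotes the set of equivalence classes of $c$-extension modules $E$ equipped with identifications (isomorphisms) $E_i/E_{i+1}\cong L_i$ for $i=0,\ldots,c$,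 such that, under these identifications, the short exact sequence $0\leftarrow E_i/E_{i+1}\leftarrow E_i/E_{i+2}\leftarrow E_{i+1}/E_{i+2}\leftarrow 0$ represents $\eta^{L_i}_{L_{i+1}}$ for all $i=0,\ldots,c-1$. Two such $E,E'$ are equivalent if there is an isomorphism $\alpha:E\to E'$ that maps $E_i$ isomorphically onto $E'_i$ for all $i$ and is compatible with the identifications of the subfactors with the $L_i$ (i.e. induces the identity on them). *)

theory Defs
  imports "HOL-Algebra.Module" "HOL-Algebra.AbelCoset"
begin

section \<open>Left modules over a ring that need not be commutative\<close>

text \<open>The locale \<^locale>\<open>module\<close> requires a commutative ring of scalars.  The
  following is the same list of axioms over an arbitrary ring with one.  We reuse the record
  type \<^typ>\<open>('r, 'm) module\<close>; its multiplicative fields \<^const>\<open>mult\<close> and \<^const>\<open>one\<close>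
  play no role.\<close>

locale left_module = R?: ring R + M?: abelian_group M
  for R (structure) and M (structure) +
  assumes smult_closed:
      "\<lbrakk>a \<in> carrier R; x \<in> carrier M\<rbrakk> \<Longrightarrow> a \<odot>\<^bsub>M\<^esub> x \<in> carrier M"
    and smult_l_distr:
      "\<lbrakk>a \<in> carrier R; b \<in> carrier R; x \<in> carrier M\<rbrakk> \<Longrightarrow>
       (a \<oplus> b) \<odot>\<^bsub>M\<^esub> x = a \<odot>\<^bsub>M\<^esub> x \<oplus>\<^bsub>M\<^esub> b \<odot>\<^bsub>M\<^esub> x"
    and smult_r_distr:
      "\<lbrakk>a \<in> carrier R; x \<in> carrier M; y \<in> carrier M\<rbrakk> \<Longrightarrow>
       a \<odot>\<^bsub>M\<^esub> (x \<oplus>\<^bsub>M\<^esub> y) = a \<odot>\<^bsub>M\<^esub> x \<oplus>\<^bsub>M\<^esub> a \<odot>\<^bsub>M\<^esub> y"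
    and smult_assoc1:
      "\<lbrakk>a \<in> carrier R; b \<in> carrier R; x \<in> carrier M\<rbrakk> \<Longrightarrow>
       (a \<otimes> b) \<odot>\<^bsub>M\<^esub> x = a \<odot>\<^bsub>M\<^esub> (b \<odot>\<^bsub>M\<^esub> x)"
    and smult_one: "x \<in> carrier M \<Longrightarrow> \<one> \<odot>\<^bsub>M\<^esub> x = x"

lemma (in left_module) smult_r_null:
  assumes "a \<in> carrier R"
  shows "a \<odot>\<^bsub>M\<^esub> \<zero>\<^bsub>M\<^esub> = \<zero>\<^bsub>M\<^esub>"
proof -
  have c: "a \<odot>\<^bsub>M\<^esub> \<zero>\<^bsub>M\<^esub> \<in> carrier M" using assms by (simp add: smult_closed)
  have "a \<odot>\<^bsub>M\<^esub> \<zero>\<^bsub>M\<^esub> \<oplus>\<^bsub>M\<^esub> a \<odot>\<^bsub>M\<^esub> \<zero>\<^bsub>M\<^esub> = a \<odot>\<^bsub>M\<^esub> \<zero>\<^bsub>M\<^esub>"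
    using smult_r_distr[OF assms M.zero_closed M.zero_closed] by (simp only: M.l_zero M.zero_closed)
  then show ?thesis using M.add.l_cancel_one[OF c c] by simp
qed

lemma module_iff_left_module: "module R M \<longleftrightarrow> cring R \<and> left_module R M"
  unfolding module_def left_module_def module_axioms_def left_module_axioms_def
  by (auto simp: cring_def)

definition lmod_hom ::
  "('r, 'x) ring_scheme \<Rightarrow> ('r, 'a) module \<Rightarrow> ('r, 'b) module \<Rightarrow> ('a \<Rightarrow> 'b) set"
where
  "lmod_hom D M N =
    {h \<in> hom (add_monoid M) (add_monoid N).
       \<forall>r \<in> carrier D. \<forall>x \<in> carrier M. h (r \<odot>\<^bsub>M\<^esub> x) = r \<odot>\<^bsub>N\<^esub> h x}"

definition lmod_iso ::
  "('r, 'x) ring_scheme \<Rightarrow> ('r, 'a) module \<Rightarrow> ('r, 'b) module \<Rightarrow> ('a \<Rightarrow> 'b) set"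
where
  "lmod_iso D M N = {h \<in> lmod_hom D M N. bij_betw h (carrier M) (carrier N)}"

lemma lmod_iso_inv:
  assumes M: "left_module D M" and h: "h \<in> lmod_iso D M N"
  shows "inv_into (carrier M) h \<in> lmod_iso D N M"
proof -
  interpret left_module D M by (rule M)
  let ?k = "inv_into (carrier M) h"
  have bij: "bij_betw h (carrier M) (carrier N)"
    and add: "\<And>x y. \<lbrakk>x \<in> carrier M; y \<in> carrier M\<rbrakk> \<Longrightarrow> h (x \<oplus>\<^bsub>M\<^esub> y) = h x \<oplus>\<^bsub>N\<^esub> h y"
    and sm: "\<And>r x. \<lbrakk>r \<in> carrier D; x \<in> carrier M\<rbrakk> \<Longrightarrow> h (r \<odot>\<^bsub>M\<^esub> x) = r \<odot>\<^bsub>N\<^esub> h x"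
    using h by (auto simp: lmod_iso_def lmod_hom_def hom_def)
  have k: "?k y \<in> carrier M" "h (?k y) = y" if "y \<in> carrier N" for y
    using bij that by (auto simp: bij_betw_def f_inv_into_f inv_into_into)
  have kh: "?k (h x) = x" if "x \<in> carrier M" for x
    using bij that by (simp add: bij_betw_def)
  have "?k (x \<oplus>\<^bsub>N\<^esub> y) = ?k x \<oplus>\<^bsub>M\<^esub> ?k y" if "x \<in> carrier N" "y \<in> carrier N" for x y
    using kh[of "?k x \<oplus>\<^bsub>M\<^esub> ?k y"] add[of "?k x" "?k y"] k that by simp
  moreover have "?k (r \<odot>\<^bsub>N\<^esub> y) = r \<odot>\<^bsub>M\<^esub> ?k y" if "r \<in> carrier D" "y \<in> carrier N" for r y
    using kh[of "r \<odot>\<^bsub>M\<^esub> ?k y"] sm[of r "?k y"] k that by (simp add: smult_closed)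
  ultimately show ?thesis
    using k bij_betw_inv_into[OF bij] by (simp add: lmod_iso_def lmod_hom_def hom_def Pi_iff)
qed

definition lmod_quot :: "('r, 'a) module \<Rightarrow> 'a set \<Rightarrow> ('r, 'a set) module" where
  "lmod_quot M N =
    \<lparr>carrier = a_rcosets\<^bsub>M\<^esub> N, mult = undefined, one = undefined,
     zero = N, add = set_add M, smult = (\<lambda>r X. \<Union>x\<in>X. N +>\<^bsub>M\<^esub> (r \<odot>\<^bsub>M\<^esub> x))\<rparr>"


section \<open>A universe for the middle terms of extensions\<close>

text \<open>For modules with elements in \<^typ>\<open>'m\<close> over a ring with elements in \<^typ>\<open>'r\<close>, the middle
  terms of extensions have their elements in the following type.  It is infinite, at least as
  large as both \<^typ>\<open>'r\<close> and \<^typ>\<open>'m\<close>, and equipollent to its square.  Hence every module with a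
  finite filtration whose subfactors are modules on \<^typ>\<open>'m\<close> (or on the universe) is
  isomorphic to one on this type, and so is every module with a generating set no larger than
  the type.  So each short exact sequence between modules on \<^typ>\<open>'m\<close> is congruent to one in
  the universe, and the Yoneda equivalence of longer extensions is not affected by the
  restriction to it.\<close>

type_synonym ('r, 'm) univ = "('r + 'm) list"

lemma univ_infinite: "infinite (UNIV :: ('r, 'm) univ set)"
  by (rule infinite_UNIV_listI)

definition to_univ :: "'m \<Rightarrow> ('r, 'm) univ" where
  "to_univ x = [Inr x]"

definition of_univ :: "('r, 'm) univ \<Rightarrow> 'm" where
  "of_univ u = projr (hd u)"

lemma of_univ_to_univ [simp]: "of_univ (to_univ x) = x"
  by (simp add: to_univ_def of_univ_def)

definition univ_copy :: "('r, 'm) module \<Rightarrow> ('r, ('r, 'm) univ) module" where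
  "univ_copy M =
    \<lparr>carrier = to_univ ` carrier M, mult = undefined, one = undefined,
     zero = to_univ \<zero>\<^bsub>M\<^esub>,
     add = (\<lambda>u v. to_univ (of_univ u \<oplus>\<^bsub>M\<^esub> of_univ v)),
     smult = (\<lambda>r u. to_univ (r \<odot>\<^bsub>M\<^esub> of_univ u))\<rparr>"

lemma left_module_univ_copy:
  fixes M :: "('r, 'm) module"
  assumes "left_module D M"
  shows "left_module D (univ_copy M)"
proof -
  interpret left_module D M by (rule assms)
  show ?thesis
  proof (intro left_module.intro left_module_axioms.intro)
    show "ring D" by (rule R.ring_axioms)
    have "\<exists>y\<in>carrier M. (to_univ (y \<oplus>\<^bsub>M\<^esub> x) :: ('r, 'm) univ) = to_univ \<zero>\<^bsub>M\<^esub>"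
      if "x \<in> carrier M" for x
      using that by (intro bexI[of _ "\<ominus>\<^bsub>M\<^esub> x"]) (simp_all add: M.l_neg)
    then show "abelian_group (univ_copy M)"
      by (intro abelian_groupI) (auto simp: univ_copy_def M.a_ac)
  qed (auto simp: univ_copy_def smult_closed smult_l_distr smult_r_distr smult_assoc1 smult_one)
qed


section \<open>Short exact sequences and $\mathrm{Ext}^1$\<close>

text \<open>The sequence $0 \leftarrow A \leftarrow G \leftarrow B \leftarrow 0$; the end terms
  are parameters of the predicates below.\<close>

record ('r, 'm, 'g) ext1 =
  mid :: "('r, 'g) module"
  prj :: "'g \<Rightarrow> 'm"
  inc :: "'m \<Rightarrow> 'g"

definition short_exact ::
  "('r, 'x) ring_scheme \<Rightarrow> ('r, 'm) module \<Rightarrow> ('r, 'm) module \<Rightarrow> ('r, 'm, 'g) ext1 \<Rightarrow> bool"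
where
  "short_exact D A B X \<longleftrightarrow>
     left_module D A \<and> left_module D (mid X) \<and> left_module D B \<and>
     prj X \<in> lmod_hom D (mid X) A \<and> inc X \<in> lmod_hom D B (mid X) \<and>
     prj X ` carrier (mid X) = carrier A \<and>
     inc X ` carrier B = a_kernel (mid X) A (prj X) \<and>
     inj_on (inc X) (carrier B)"

definition congruent_ext1 ::
  "('r, 'x) ring_scheme \<Rightarrow> ('r, 'm) module \<Rightarrow> ('r, 'm) module \<Rightarrow>
   ('r, 'm, 'g) ext1 \<Rightarrow> ('r, 'm, 'h) ext1 \<Rightarrow> bool"
where
  "congruent_ext1 D A B X Y \<longleftrightarrow>
     (\<exists>h \<in> lmod_iso D (mid X) (mid Y).
        (\<forall>b \<in> carrier B. h (inc X b) = inc Y b) \<and>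
        (\<forall>g \<in> carrier (mid X). prj Y (h g) = prj X g))"

definition ext1_seqs ::
  "('r, 'x) ring_scheme \<Rightarrow> ('r, 'm) module \<Rightarrow> ('r, 'm) module \<Rightarrow>
   ('r, 'm, ('r, 'm) univ) ext1 set"
where
  "ext1_seqs D A B = {X. short_exact D A B X}"

definition ext1_rel ::
  "('r, 'x) ring_scheme \<Rightarrow> ('r, 'm) module \<Rightarrow> ('r, 'm) module \<Rightarrow>
   ('r, 'm, ('r, 'm) univ) ext1 rel"
where
  "ext1_rel D A B =
     {(X, Y). X \<in> ext1_seqs D A B \<and> Y \<in> ext1_seqs D A B \<and> congruent_ext1 D A B X Y}"

definition Ext1 ::
  "('r, 'x) ring_scheme \<Rightarrow> ('r, 'm) module \<Rightarrow> ('r, 'm) module \<Rightarrow>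
   ('r, 'm, ('r, 'm) univ) ext1 set set"
where
  "Ext1 D A B = ext1_seqs D A B // ext1_rel D A B"

lemma equiv_ext1_rel: "equiv (ext1_seqs D A B) (ext1_rel D A B)"
proof (rule equivI)
  show "ext1_rel D A B \<subseteq> ext1_seqs D A B \<times> ext1_seqs D A B"
    by (auto simp: ext1_rel_def)
  show "refl_on (ext1_seqs D A B) (ext1_rel D A B)"
    by (rule refl_onI)
      (auto simp: ext1_rel_def congruent_ext1_def lmod_iso_def lmod_hom_def hom_def
         intro!: bexI[of _ "\<lambda>x. x"] bij_betwI')
  show "sym (ext1_rel D A B)"
  proof (rule symI)
    fix X Y assume XY: "(X, Y) \<in> ext1_rel D A B"
    then have X: "short_exact D A B X" and Y: "short_exact D A B Y"
      by (auto simp: ext1_rel_def ext1_seqs_def)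
    from XY obtain h where h: "h \<in> lmod_hom D (mid X) (mid Y)"
      "bij_betw h (carrier (mid X)) (carrier (mid Y))"
      and hi: "\<forall>b\<in>carrier B. h (inc X b) = inc Y b"
      and hp: "\<forall>g\<in>carrier (mid X). prj Y (h g) = prj X g"
      by (auto simp: ext1_rel_def congruent_ext1_def lmod_iso_def)
    define k where "k = inv_into (carrier (mid X)) h"
    have iso: "k \<in> lmod_iso D (mid Y) (mid X)"
      using X Y h unfolding k_def by (intro lmod_iso_inv) (auto simp: short_exact_def lmod_iso_def)
    have kh: "k (h g) = g" if "g \<in> carrier (mid X)" for g
      using h that by (simp add: k_def bij_betw_def)
    have hk: "h (k g) = g" and kc: "k g \<in> carrier (mid X)" if "g \<in> carrier (mid Y)" for g
      using h that by (auto simp: k_def bij_betw_def f_inv_into_f inv_into_into)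
    have "k (inc Y b) = inc X b" if b: "b \<in> carrier B" for b
    proof -
      have "inc X b \<in> carrier (mid X)"
        using X b by (auto simp: short_exact_def lmod_hom_def hom_def)
      then show ?thesis using kh hi b by metis
    qed
    moreover have "prj X (k g) = prj Y g" if "g \<in> carrier (mid Y)" for g
      using hp hk kc that by metis
    ultimately have "congruent_ext1 D A B Y X"
      using iso unfolding congruent_ext1_def by blast
    then show "(Y, X) \<in> ext1_rel D A B" using X Y by (simp add: ext1_rel_def ext1_seqs_def)
  qed
  show "trans (ext1_rel D A B)"
  proof (rule transI)
    fix X Y Z assume XY: "(X, Y) \<in> ext1_rel D A B" and YZ: "(Y, Z) \<in> ext1_rel D A B"
    then obtain h k where h: "h \<in> lmod_iso D (mid X) (mid Y)" "k \<in> lmod_iso D (mid Y) (mid Z)"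
      and hk: "\<forall>b\<in>carrier B. h (inc X b) = inc Y b" "\<forall>g\<in>carrier (mid X). prj Y (h g) = prj X g"
        "\<forall>b\<in>carrier B. k (inc Y b) = inc Z b" "\<forall>g\<in>carrier (mid Y). prj Z (k g) = prj Y g"
      unfolding ext1_rel_def congruent_ext1_def by blast
    have mem: "h g \<in> carrier (mid Y)" if "g \<in> carrier (mid X)" for g
      using h that by (auto simp: lmod_iso_def bij_betw_def)
    have "k \<circ> h \<in> lmod_hom D (mid X) (mid Z)"
      using h by (auto simp: lmod_iso_def lmod_hom_def hom_def Pi_iff)
    then have "k \<circ> h \<in> lmod_iso D (mid X) (mid Z)"
      using h by (auto simp: lmod_iso_def intro: bij_betw_trans)
    then have "congruent_ext1 D A B X Z"
      unfolding congruent_ext1_def using hk mem by (intro bexI[of _ "k \<circ> h"]) auto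
    then show "(X, Z) \<in> ext1_rel D A B" using XY YZ by (simp add: ext1_rel_def)
  qed
qed

text \<open>The middle term of \<^term>\<open>X\<close> may live on any type here, not just on the universe.\<close>

definition represents ::
  "('r, 'x) ring_scheme \<Rightarrow> ('r, 'm) module \<Rightarrow> ('r, 'm) module \<Rightarrow>
   ('r, 'm, 'g) ext1 \<Rightarrow> ('r, 'm, ('r, 'm) univ) ext1 set \<Rightarrow> bool"
where
  "represents D A B X \<eta> \<longleftrightarrow>
     short_exact D A B X \<and> (\<exists>Y \<in> \<eta>. congruent_ext1 D A B X Y)"


section \<open>Yoneda $\mathrm{Ext}^2$\<close>

text \<open>The sequence $0 \leftarrow A \leftarrow G_0 \leftarrow G_1 \leftarrow C \leftarrow 0$.\<close>

record ('r, 'm, 'g) ext2 =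
  mid0 :: "('r, 'g) module"
  mid1 :: "('r, 'g) module"
  prj2 :: "'g \<Rightarrow> 'm"
  dif2 :: "'g \<Rightarrow> 'g"
  inc2 :: "'m \<Rightarrow> 'g"

definition ext2_seqs ::
  "('r, 'x) ring_scheme \<Rightarrow> ('r, 'm) module \<Rightarrow> ('r, 'm) module \<Rightarrow>
   ('r, 'm, ('r, 'm) univ) ext2 set"
where
  "ext2_seqs D A C =
     {X. left_module D A \<and> left_module D (mid0 X) \<and> left_module D (mid1 X) \<and> left_module D C \<and>
         prj2 X \<in> lmod_hom D (mid0 X) A \<and>
         dif2 X \<in> lmod_hom D (mid1 X) (mid0 X) \<and>
         inc2 X \<in> lmod_hom D C (mid1 X) \<and>
         prj2 X ` carrier (mid0 X) = carrier A \<and>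
         dif2 X ` carrier (mid1 X) = a_kernel (mid0 X) A (prj2 X) \<and>
         inc2 X ` carrier C = a_kernel (mid1 X) (mid0 X) (dif2 X) \<and>
         inj_on (inc2 X) (carrier C)}"

text \<open>Morphisms of 2-fold extensions that are the identity on both ends.\<close>

definition ext2_mor ::
  "('r, 'x) ring_scheme \<Rightarrow> ('r, 'm) module \<Rightarrow> ('r, 'm) module \<Rightarrow>
   ('r, 'm, ('r, 'm) univ) ext2 rel"
where
  "ext2_mor D A C =
     {(X, Y). X \<in> ext2_seqs D A C \<and> Y \<in> ext2_seqs D A C \<and>
        (\<exists>f0 \<in> lmod_hom D (mid0 X) (mid0 Y). \<exists>f1 \<in> lmod_hom D (mid1 X) (mid1 Y).
           (\<forall>g \<in> carrier (mid0 X). prj2 Y (f0 g) = prj2 X g) \<and>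
           (\<forall>g \<in> carrier (mid1 X). dif2 Y (f1 g) = f0 (dif2 X g)) \<and>
           (\<forall>c \<in> carrier C. f1 (inc2 X c) = inc2 Y c))}"

text \<open>The existence of a morphism is not symmetric; Yoneda equivalence is the equivalence
  relation it generates.\<close>

definition ext2_rel ::
  "('r, 'x) ring_scheme \<Rightarrow> ('r, 'm) module \<Rightarrow> ('r, 'm) module \<Rightarrow>
   ('r, 'm, ('r, 'm) univ) ext2 rel"
where
  "ext2_rel D A C = Restr ((ext2_mor D A C \<union> (ext2_mor D A C)\<inverse>)\<^sup>*) (ext2_seqs D A C)"

definition Ext2 ::
  "('r, 'x) ring_scheme \<Rightarrow> ('r, 'm) module \<Rightarrow> ('r, 'm) module \<Rightarrow>
   ('r, 'm, ('r, 'm) univ) ext2 set set"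
where
  "Ext2 D A C = ext2_seqs D A C // ext2_rel D A C"

text \<open>The zero element of $\mathrm{Ext}^2(A, C)$ under Baer sum is the class of
  $0 \leftarrow A \xleftarrow{\mathrm{id}} A \xleftarrow{0} C \xleftarrow{\mathrm{id}} C
  \leftarrow 0$.\<close>

definition trivial_ext2 ::
  "('r, 'm) module \<Rightarrow> ('r, 'm) module \<Rightarrow> ('r, 'm, ('r, 'm) univ) ext2"
where
  "trivial_ext2 A C =
    \<lparr>mid0 = univ_copy A, mid1 = univ_copy C,
     prj2 = of_univ, dif2 = (\<lambda>_. \<zero>\<^bsub>univ_copy A\<^esub>), inc2 = to_univ\<rparr>"

definition Ext2_zero ::
  "('r, 'x) ring_scheme \<Rightarrow> ('r, 'm) module \<Rightarrow> ('r, 'm) module \<Rightarrow>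
   ('r, 'm, ('r, 'm) univ) ext2 set"
where
  "Ext2_zero D A C = ext2_rel D A C `` {trivial_ext2 A C}"

definition yoneda_splice ::
  "('r, 'm, 'g) ext1 \<Rightarrow> ('r, 'm, 'g) ext1 \<Rightarrow> ('r, 'm, 'g) ext2"
where
  "yoneda_splice X Y =
    \<lparr>mid0 = mid X, mid1 = mid Y,
     prj2 = prj X, dif2 = inc X \<circ> prj Y, inc2 = inc Y\<rparr>"

text \<open>The union is over the single class of all splices of representatives, see
  \<open>yoneda_prod_eq\<close> below.\<close>

definition yoneda_prod ::
  "('r, 'x) ring_scheme \<Rightarrow> ('r, 'm) module \<Rightarrow> ('r, 'm) module \<Rightarrow>
   ('r, 'm, ('r, 'm) univ) ext1 set \<Rightarrow> ('r, 'm, ('r, 'm) univ) ext1 set \<Rightarrow>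
   ('r, 'm, ('r, 'm) univ) ext2 set"
where
  "yoneda_prod D A C \<eta> \<eta>' = (\<Union>X\<in>\<eta>. \<Union>Y\<in>\<eta>'. ext2_rel D A C `` {yoneda_splice X Y})"

lemma equiv_ext2_rel: "equiv (ext2_seqs D A C) (ext2_rel D A C)"
proof -
  let ?r = "ext2_mor D A C \<union> (ext2_mor D A C)\<inverse>"
  have "sym (?r\<^sup>*)" by (rule sym_rtrancl) (auto simp: sym_def)
  then show ?thesis
    unfolding ext2_rel_def
    by (intro equivI) (auto simp: refl_on_def sym_def intro!: transI intro: rtrancl_trans)
qed

lemma trivial_ext2_in_seqs:
  assumes "left_module D A" "left_module D C"
  shows "trivial_ext2 A C \<in> ext2_seqs D A C"
proof -
  interpret A: left_module D A by (rule assms)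
  interpret C: left_module D C by (rule assms)
  show ?thesis
    using assms left_module_univ_copy[OF assms(1)] left_module_univ_copy[OF assms(2)]
    by (auto simp: ext2_seqs_def trivial_ext2_def lmod_hom_def hom_def univ_copy_def
         a_kernel_def kernel_def A.smult_closed A.smult_r_null image_image
         intro!: inj_onI dest: arg_cong[of "to_univ _" _ of_univ])
qed

lemma Ext2_zero_in_Ext2:
  "\<lbrakk>left_module D A; left_module D C\<rbrakk> \<Longrightarrow> Ext2_zero D A C \<in> Ext2 D A C"
  unfolding Ext2_zero_def Ext2_def by (intro quotientI trivial_ext2_in_seqs)

lemma yoneda_splice_in_seqs:
  assumes "X \<in> ext1_seqs D A B" "Y \<in> ext1_seqs D B C"
  shows "yoneda_splice X Y \<in> ext2_seqs D A C"
proof -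
  have X: "short_exact D A B X" and Y: "short_exact D B C Y"
    using assms by (auto simp: ext1_seqs_def)
  interpret G: left_module D "mid X" using X by (simp add: short_exact_def)
  interpret B: left_module D B using X by (simp add: short_exact_def)
  have "inc X \<in> hom (add_monoid B) (add_monoid (mid X))"
    using X by (simp add: short_exact_def lmod_hom_def)
  then have 0: "inc X \<zero>\<^bsub>B\<^esub> = \<zero>\<^bsub>mid X\<^esub>"
    using hom_one[OF _ B.a_group G.a_group] by fastforce
  have "inc X \<circ> prj Y \<in> lmod_hom D (mid Y) (mid X)"
    using X Y by (auto simp: short_exact_def lmod_hom_def hom_def Pi_iff)
  moreover have "(inc X \<circ> prj Y) ` carrier (mid Y) = a_kernel (mid X) A (prj X)"
    using X Y by (simp only: short_exact_def image_comp[symmetric])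
  moreover have "a_kernel (mid Y) (mid X) (inc X \<circ> prj Y) = a_kernel (mid Y) B (prj Y)"
  proof -
    have "inc X (prj Y g) = \<zero>\<^bsub>mid X\<^esub> \<longleftrightarrow> prj Y g = \<zero>\<^bsub>B\<^esub>" if "g \<in> carrier (mid Y)" for g
    proof -
      have "prj Y g \<in> carrier B" "inj_on (inc X) (carrier B)"
        using X Y that by (auto simp: short_exact_def)
      then show ?thesis using inj_on_eq_iff[of "inc X" "carrier B" "prj Y g" "\<zero>\<^bsub>B\<^esub>"]
        unfolding 0 by simp
    qed
    then show ?thesis by (auto simp: a_kernel_def kernel_def)
  qed
  ultimately show ?thesis
    using X Y by (simp add: ext2_seqs_def yoneda_splice_def short_exact_def)
qed

lemma yoneda_prod_eq:
  assumes \<eta>: "\<eta> \<in> Ext1 D A B" "\<eta>' \<in> Ext1 D B C" and XY: "X \<in> \<eta>" "Y \<in> \<eta>'"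
  shows "yoneda_prod D A C \<eta> \<eta>' = ext2_rel D A C `` {yoneda_splice X Y}"
proof -
  have "ext2_rel D A C `` {yoneda_splice X' Y'} = ext2_rel D A C `` {yoneda_splice X Y}"
    if "X' \<in> \<eta>" "Y' \<in> \<eta>'" for X' Y'
  proof -
    have rel: "(X, X') \<in> ext1_rel D A B" "(Y, Y') \<in> ext1_rel D B C"
      using \<eta> XY that quotient_eq_iff[OF equiv_ext1_rel] unfolding Ext1_def by metis+
    then obtain f0 f1 where f: "f0 \<in> lmod_hom D (mid X) (mid X')" "f1 \<in> lmod_hom D (mid Y) (mid Y')"
      and eqs: "\<forall>b\<in>carrier B. f0 (inc X b) = inc X' b" "\<forall>g\<in>carrier (mid X). prj X' (f0 g) = prj X g"
        "\<forall>b\<in>carrier C. f1 (inc Y b) = inc Y' b" "\<forall>g\<in>carrier (mid Y). prj Y' (f1 g) = prj Y g"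
      unfolding ext1_rel_def congruent_ext1_def lmod_iso_def by blast
    have seqs: "yoneda_splice X Y \<in> ext2_seqs D A C" "yoneda_splice X' Y' \<in> ext2_seqs D A C"
      using rel by (auto simp: ext1_rel_def intro: yoneda_splice_in_seqs)
    have "prj Y g \<in> carrier B" if "g \<in> carrier (mid Y)" for g
      using rel that by (auto simp: ext1_rel_def ext1_seqs_def short_exact_def)
    then have "(yoneda_splice X Y, yoneda_splice X' Y') \<in> ext2_mor D A C"
      using seqs f eqs unfolding ext2_mor_def
      by (simp add: yoneda_splice_def,
          intro bexI[of _ f0] conjI bexI[of _ f1]) simp_all
    then have "(yoneda_splice X Y, yoneda_splice X' Y') \<in> ext2_rel D A C"
      using seqs by (auto simp: ext2_rel_def)
    then show ?thesis using equiv_class_eq[OF equiv_ext2_rel] by metis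
  qed
  then show ?thesis unfolding yoneda_prod_def using XY by blast
qed


section \<open>Extension modules\<close>

text \<open>A module \<open>E\<close> with a descending chain \<open>F 0, F 1, \<dots>\<close> of subsets and maps \<open>\<phi> i\<close>
  from the subfactors \<open>F i / F (i + 1)\<close>.  Only finitely many indices are relevant.\<close>

record ('r, 'm, 'e) ext_module =
  emod :: "('r, 'e) module"
  chain :: "nat \<Rightarrow> 'e set"
  ident :: "nat \<Rightarrow> 'e set \<Rightarrow> 'm"

definition c_extension_module ::
  "('r, 'x) ring_scheme \<Rightarrow> nat \<Rightarrow> ('r, 'e) module \<Rightarrow> (nat \<Rightarrow> 'e set) \<Rightarrow> bool"
where
  "c_extension_module D c E F \<longleftrightarrow>
     left_module D E \<and> F 0 = carrier E \<and> F (c + 1) = {\<zero>\<^bsub>E\<^esub>} \<and>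
     (\<forall>i \<le> c + 1. submodule (F i) D E) \<and> (\<forall>i \<le> c. F (i + 1) \<subseteq> F i)"

definition subfactor ::
  "('r, 'm, 'e) ext_module \<Rightarrow> nat \<Rightarrow> nat \<Rightarrow> ('r, 'e set) module"
where
  "subfactor W i j = lmod_quot (emod W\<lparr>carrier := chain W i\<rparr>) (chain W j)"

text \<open>The sequence
  $0 \leftarrow E_i/E_{i+1} \leftarrow E_i/E_{i+2} \leftarrow E_{i+1}/E_{i+2} \leftarrow 0$,
  with its ends replaced by $L_i$ and $L_{i+1}$ along the identifications.  The canonical
  projection sends a coset \<open>X\<close> of $E_{i+2}$ to $E_{i+1} + X$; the canonical inclusion
  is the identity, as a coset of $E_{i+2}$ in $E_{i+1}$ is also one in $E_i$.\<close>

definition subfactor_seq ::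
  "('r, 'm, 'e) ext_module \<Rightarrow> nat \<Rightarrow> ('r, 'm, 'e set) ext1"
where
  "subfactor_seq W i =
    \<lparr>mid = subfactor W i (i + 2),
     prj = (\<lambda>X. ident W i (chain W (i + 1) <+>\<^bsub>emod W\<^esub> X)),
     inc = inv_into (carrier (subfactor W (i + 1) (i + 2))) (ident W (i + 1))\<rparr>"

definition ExtMod_data ::
  "('r, 'x) ring_scheme \<Rightarrow> nat \<Rightarrow> (nat \<Rightarrow> ('r, 'm) module) \<Rightarrow>
   (nat \<Rightarrow> ('r, 'm, ('r, 'm) univ) ext1 set) \<Rightarrow> ('r, 'm, ('r, 'm) univ) ext_module set"
where
  "ExtMod_data D c L \<eta> =
     {W. c_extension_module D c (emod W) (chain W) \<and>
         (\<forall>i \<le> c. ident W i \<in> lmod_iso D (subfactor W i (i + 1)) (L i)) \<and>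
         (\<forall>i < c. represents D (L i) (L (i + 1)) (subfactor_seq W i) (\<eta> i))}"

definition ExtMod_rel ::
  "('r, 'x) ring_scheme \<Rightarrow> nat \<Rightarrow> (nat \<Rightarrow> ('r, 'm) module) \<Rightarrow>
   (nat \<Rightarrow> ('r, 'm, ('r, 'm) univ) ext1 set) \<Rightarrow> ('r, 'm, ('r, 'm) univ) ext_module rel"
where
  "ExtMod_rel D c L \<eta> =
     {(W, W'). W \<in> ExtMod_data D c L \<eta> \<and> W' \<in> ExtMod_data D c L \<eta> \<and>
        (\<exists>\<alpha> \<in> lmod_iso D (emod W) (emod W').
           (\<forall>i \<le> c + 1. \<alpha> ` chain W i = chain W' i) \<and>
           (\<forall>i \<le> c. \<forall>X \<in> carrier (subfactor W i (i + 1)). ident W' i (\<alpha> ` X) = ident W i X))}"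

text \<open>\<^term>\<open>\<eta> i\<close> stands for $\eta^{L_i}_{L_{i+1}}$.\<close>

definition ExtMod ::
  "('r, 'x) ring_scheme \<Rightarrow> nat \<Rightarrow> (nat \<Rightarrow> ('r, 'm) module) \<Rightarrow>
   (nat \<Rightarrow> ('r, 'm, ('r, 'm) univ) ext1 set) \<Rightarrow> ('r, 'm, ('r, 'm) univ) ext_module set set"
where
  "ExtMod D c L \<eta> = ExtMod_data D c L \<eta> // ExtMod_rel D c L \<eta>"

end

theory Submission
  imports Defs
begin

text \<open>Write \<open>A\<close>, \<open>B\<close>, \<open>C\<close> for three consecutive subfactors of the filtration, starting with
  \<open>A = E\<^sub>a/E\<^sub>a\<^sub>+\<^sub>1\<close>.  The splice \<open>0 \<leftarrow> A \<leftarrow> E\<^sub>a/E\<^sub>a\<^sub>+\<^sub>2 \<leftarrow> E\<^sub>a\<^sub>+\<^sub>1/E\<^sub>a\<^sub>+\<^sub>3 \<leftarrow> C \<leftarrow> 0\<close> is linked to the trivial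
  sequence by the 2-extension \<open>0 \<leftarrow> A \<leftarrow> E\<^sub>a \<leftarrow> E\<^sub>a\<^sub>+\<^sub>1 \<oplus> C \<leftarrow> C \<leftarrow> 0\<close>, whose middle map is
  \<open>(n, c) \<mapsto> n\<close>: it maps to the trivial sequence by the projections \<open>E\<^sub>a \<rightarrow> A\<close> and
  \<open>(n, c) \<mapsto> c\<close>, and to the splice by the projection of \<open>E\<^sub>a\<close> and by \<open>(n, c) \<mapsto> [n] + c\<close>.\<close>

section \<open>Submodules and quotients\<close>

lemma lmod_homI:
  assumes "\<And>x. x \<in> carrier M \<Longrightarrow> h x \<in> carrier N"
    and "\<And>x y. \<lbrakk>x \<in> carrier M; y \<in> carrier M\<rbrakk> \<Longrightarrow> h (x \<oplus>\<^bsub>M\<^esub> y) = h x \<oplus>\<^bsub>N\<^esub> h y"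
    and "\<And>r x. \<lbrakk>r \<in> carrier D; x \<in> carrier M\<rbrakk> \<Longrightarrow> h (r \<odot>\<^bsub>M\<^esub> x) = r \<odot>\<^bsub>N\<^esub> h x"
  shows "h \<in> lmod_hom D M N"
  using assms by (simp add: lmod_hom_def hom_def)

lemma lmod_homD:
  assumes "h \<in> lmod_hom D M N"
  shows "x \<in> carrier M \<Longrightarrow> h x \<in> carrier N"
    and "\<lbrakk>x \<in> carrier M; y \<in> carrier M\<rbrakk> \<Longrightarrow> h (x \<oplus>\<^bsub>M\<^esub> y) = h x \<oplus>\<^bsub>N\<^esub> h y"
    and "\<lbrakk>r \<in> carrier D; x \<in> carrier M\<rbrakk> \<Longrightarrow> h (r \<odot>\<^bsub>M\<^esub> x) = r \<odot>\<^bsub>N\<^esub> h x"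
  using assms by (auto simp: lmod_hom_def hom_def)

lemma lmod_hom_zero:
  assumes "left_module D M" "left_module D N" "h \<in> lmod_hom D M N"
  shows "h \<zero>\<^bsub>M\<^esub> = \<zero>\<^bsub>N\<^esub>"
proof -
  interpret M: left_module D M by (rule assms)
  interpret N: left_module D N by (rule assms)
  show ?thesis
    using hom_one[OF _ M.a_group N.a_group] assms(3) by (fastforce simp: lmod_hom_def)
qed

lemma lmod_hom_comp:
  assumes "h \<in> lmod_hom D M N" "k \<in> lmod_hom D N P"
  shows "(\<lambda>x. k (h x)) \<in> lmod_hom D M P"
  using assms by (auto simp: lmod_hom_def hom_def Pi_iff)

lemma submodule_restrict:
  assumes "left_module D M" "submodule N D M" "submodule P D M" "P \<subseteq> N"
  shows "submodule P D (M\<lparr>carrier := N\<rparr>)"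
proof -
  interpret M: left_module D M by (rule assms)
  have "subgroup P ((add_monoid M)\<lparr>carrier := N\<rparr>)"
    using assms by (intro M.add.subgroup_incl) (auto simp: submodule_def)
  then show ?thesis
    using assms(3) by (simp add: submodule_def submodule_axioms_def)
qed

lemma left_module_restrict:
  assumes "left_module D M" "submodule N D M"
  shows "left_module D (M\<lparr>carrier := N\<rparr>)"
proof -
  interpret M: left_module D M by (rule assms)
  interpret N: submodule N D M by (rule assms)
  have mem: "x \<in> carrier M" if "x \<in> N" for x using N.subset that by auto
  have neg: "\<exists>y\<in>N. y \<oplus>\<^bsub>M\<^esub> x = \<zero>\<^bsub>M\<^esub>" if "x \<in> N" for x
    using N.m_inv_closed[OF that] that mem
    by (intro bexI[of _ "\<ominus>\<^bsub>M\<^esub> x"]) (auto simp: M.l_neg a_inv_def[symmetric])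
  show ?thesis
  proof (intro left_module.intro left_module_axioms.intro)
    show "ring D" by (rule M.R.ring_axioms)
    show "abelian_group (M\<lparr>carrier := N\<rparr>)"
      using N.m_closed N.one_closed neg by (intro abelian_groupI) (auto simp: mem M.a_ac)
  qed (auto simp: mem M.smult_l_distr M.smult_r_distr M.smult_assoc1 M.smult_one)
qed

text \<open>These three facts carry every use of \<open>lmod_quot\<close> below, whose scalar action
  is a union over all representatives of a coset.\<close>

lemma quot_proj:
  assumes M: "left_module D M" and N: "submodule N D M"
  shows "a_r_coset M N \<in> lmod_hom D M (lmod_quot M N)"
    and "a_r_coset M N ` carrier M = carrier (lmod_quot M N)"
    and "x \<in> carrier M \<Longrightarrow> N +>\<^bsub>M\<^esub> x = N \<longleftrightarrow> x \<in> N"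
proof -
  interpret M: left_module D M by (rule M)
  interpret N: submodule N D M by (rule N)
  have sub: "subgroup N (add_monoid M)" by (rule N.subgroup_axioms)
  have NM: "N \<subseteq> carrier M" using N.subset by simp
  interpret S: abelian_subgroup N M
    by (intro abelian_subgroupI3 additive_subgroupI sub M.M.abelian_group_axioms)
  show "x \<in> carrier M \<Longrightarrow> N +>\<^bsub>M\<^esub> x = N \<longleftrightarrow> x \<in> N"
    using M.a_coset_join1[OF _ _ sub] M.a_coset_join2[OF _ sub] by blast
  show "a_r_coset M N ` carrier M = carrier (lmod_quot M N)"
    by (auto simp: lmod_quot_def A_RCOSETS_def')
  show "a_r_coset M N \<in> lmod_hom D M (lmod_quot M N)"
  proof (rule lmod_homI)
    fix r x assume r: "r \<in> carrier D" and x: "x \<in> carrier M"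
    \<comment> \<open>As N is closed under scalars, every representative of the coset of x yields
      the same coset, so the union in \<open>lmod_quot\<close> collapses to one term.\<close>
    have "N +>\<^bsub>M\<^esub> (r \<odot>\<^bsub>M\<^esub> y) = N +>\<^bsub>M\<^esub> (r \<odot>\<^bsub>M\<^esub> x)" if y: "y \<in> N +>\<^bsub>M\<^esub> x" for y
    proof -
      obtain n where n: "n \<in> N" "y = n \<oplus>\<^bsub>M\<^esub> x" using y by (auto simp: a_r_coset_def')
      then have "r \<odot>\<^bsub>M\<^esub> y = r \<odot>\<^bsub>M\<^esub> n \<oplus>\<^bsub>M\<^esub> r \<odot>\<^bsub>M\<^esub> x"
        using r x NM by (auto simp: M.smult_r_distr)
      then have "r \<odot>\<^bsub>M\<^esub> y \<in> N +>\<^bsub>M\<^esub> (r \<odot>\<^bsub>M\<^esub> x)"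
        using r n N.smult_closed by (auto simp: a_r_coset_def')
      then show ?thesis
        using M.a_repr_independence[OF _ _ sub] M.smult_closed r x by metis
    qed
    moreover have "x \<in> N +>\<^bsub>M\<^esub> x" using x by (rule S.a_rcos_self)
    ultimately have "(\<Union>y\<in>N +>\<^bsub>M\<^esub> x. N +>\<^bsub>M\<^esub> (r \<odot>\<^bsub>M\<^esub> y)) = N +>\<^bsub>M\<^esub> (r \<odot>\<^bsub>M\<^esub> x)"
      by blast
    then show "N +>\<^bsub>M\<^esub> (r \<odot>\<^bsub>M\<^esub> x) = r \<odot>\<^bsub>lmod_quot M N\<^esub> (N +>\<^bsub>M\<^esub> x)"
      by (simp add: lmod_quot_def)
  qed (use NM in \<open>auto simp: lmod_quot_def S.a_rcos_sum intro!: M.a_rcosetsI\<close>)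
qed

text \<open>Lets cosets in any E_i / E_j be written as cosets in E.\<close>

lemma a_r_coset_restrict [simp]: "a_r_coset (M\<lparr>carrier := N\<rparr>) = a_r_coset M"
  by (simp add: a_r_coset_def' fun_eq_iff)

text \<open>Since N + P = N, this evaluates the projection of \<open>subfactor_seq\<close>, which
  adds E_{i+1} to a coset of E_{i+2}.\<close>

lemma set_add_a_r_coset:
  assumes M: "left_module D M" and N: "submodule N D M" "submodule P D M" "P \<subseteq> N"
    and x: "x \<in> carrier M"
  shows "N <+>\<^bsub>M\<^esub> (P +>\<^bsub>M\<^esub> x) = N +>\<^bsub>M\<^esub> x"
proof -
  interpret M: left_module D M by (rule M)
  interpret N: submodule N D M by (rule N)
  interpret P: submodule P D M by (rule N)
  have sub: "N \<subseteq> carrier M" "P \<subseteq> carrier M" using N.subset P.subset by simp_all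
  have "N <+>\<^bsub>M\<^esub> P = N"
  proof
    show "N <+>\<^bsub>M\<^esub> P \<subseteq> N" using N.m_closed N(3) by (auto simp: set_add_def')
    show "N \<subseteq> N <+>\<^bsub>M\<^esub> P"
    proof
      fix n assume "n \<in> N"
      then have "n = n \<oplus>\<^bsub>M\<^esub> \<zero>\<^bsub>M\<^esub>" using sub by auto
      then show "n \<in> N <+>\<^bsub>M\<^esub> P" using \<open>n \<in> N\<close> P.one_closed by (auto simp: set_add_def')
    qed
  qed
  then show ?thesis using M.a_setmult_rcos_assoc[OF sub x] by simp
qed

section \<open>Direct sums inside the universe\<close>

text \<open>The pair \<open>(n, c)\<close> is encoded as the word \<open>Inr c # n\<close>.\<close>

definition univ_sum ::
  "('r, ('r, 'm) univ) module \<Rightarrow> ('r, 'm) module \<Rightarrow> ('r, ('r, 'm) univ) module"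
where
  "univ_sum N C =
    \<lparr>carrier = {Inr c # n | n c. n \<in> carrier N \<and> c \<in> carrier C},
     mult = undefined, one = undefined, zero = Inr \<zero>\<^bsub>C\<^esub> # \<zero>\<^bsub>N\<^esub>,
     add = (\<lambda>u v. Inr (of_univ u \<oplus>\<^bsub>C\<^esub> of_univ v) # (tl u \<oplus>\<^bsub>N\<^esub> tl v)),
     smult = (\<lambda>r u. Inr (r \<odot>\<^bsub>C\<^esub> of_univ u) # (r \<odot>\<^bsub>N\<^esub> tl u))\<rparr>"

lemma of_univ_Cons [simp]: "of_univ (Inr c # n) = c"
  by (simp add: of_univ_def)

lemma left_module_univ_sum:
  assumes "left_module D N" "left_module D C"
  shows "left_module D (univ_sum N C)"
proof -
  interpret N: left_module D N by (rule assms)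
  interpret C: left_module D C by (rule assms)
  show ?thesis
  proof (intro left_module.intro left_module_axioms.intro)
    show "ring D" by (rule N.R.ring_axioms)
    have "\<exists>v\<in>carrier (univ_sum N C). v \<oplus>\<^bsub>univ_sum N C\<^esub> u = \<zero>\<^bsub>univ_sum N C\<^esub>"
      if "u \<in> carrier (univ_sum N C)" for u
      using that
      by (intro bexI[of _ "Inr (\<ominus>\<^bsub>C\<^esub> of_univ u) # (\<ominus>\<^bsub>N\<^esub> tl u)"])
        (auto simp: univ_sum_def N.l_neg C.l_neg)
    then show "abelian_group (univ_sum N C)"
      by (intro abelian_groupI) (auto simp: univ_sum_def N.a_ac C.a_ac)
  qed (auto simp: univ_sum_def N.smult_closed N.smult_l_distr N.smult_r_distr N.smult_assoc1
      N.smult_one C.smult_closed C.smult_l_distr C.smult_r_distr C.smult_assoc1 C.smult_one)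
qed

section \<open>Vanishing of Yoneda products\<close>

text \<open>In the application G is E_a and N is E_{a+1}. Both live in the universe already; a
  quotient such as E_a / E_{a+3} consists of sets and would first need transport into it.\<close>

lemma splice_rel_trivial:
  fixes X Y :: "('r, 'm, ('r, 'm) univ) ext1" and G :: "('r, ('r, 'm) univ) module"
  assumes X: "X \<in> ext1_seqs D A B" and Y: "Y \<in> ext1_seqs D B C"
    and G: "left_module D G" and N: "submodule N D G"
    and p: "p \<in> lmod_hom D G A" "p ` carrier G = carrier A" "a_kernel G A p = N"
    and f: "f \<in> lmod_hom D G (mid X)" "\<And>x. x \<in> carrier G \<Longrightarrow> prj X (f x) = p x"
    and g: "g \<in> lmod_hom D (G\<lparr>carrier := N\<rparr>) (mid Y)"
      "\<And>n. n \<in> N \<Longrightarrow> inc X (prj Y (g n)) = f n"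
  shows "(yoneda_splice X Y, trivial_ext2 A C) \<in> ext2_rel D A C"
proof -
  have seX: "short_exact D A B X" and seY: "short_exact D B C Y"
    using X Y by (auto simp: ext1_seqs_def)
  interpret A: left_module D A using seX by (simp add: short_exact_def)
  interpret B: left_module D B using seX by (simp add: short_exact_def)
  interpret C: left_module D C using seY by (simp add: short_exact_def)
  interpret G: left_module D G by (rule G)
  interpret Y: left_module D "mid Y" using seY by (simp add: short_exact_def)
  define N' where "N' = G\<lparr>carrier := N\<rparr>"
  have N': "left_module D N'" unfolding N'_def by (rule left_module_restrict[OF G N])
  interpret N': left_module D N' by (rule N')
  have NG: "N \<subseteq> carrier G" using p(3) by (auto simp: a_kernel_def')
  \<comment> \<open>With (n, c) encoded as \<open>Inr c # n\<close>, the map (n, c) to n is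
    \<open>tl\<close>.\<close>
  define Z :: "('r, 'm, ('r, 'm) univ) ext2"
    where "Z = \<lparr>mid0 = G, mid1 = univ_sum N' C, prj2 = p, dif2 = tl,
      inc2 = (\<lambda>c. Inr c # \<zero>\<^bsub>G\<^esub>)\<rparr>"
  have N0: "\<zero>\<^bsub>G\<^esub> \<in> N" using N'.M.zero_closed by (simp add: N'_def)
  have Z: "Z \<in> ext2_seqs D A C"
  proof -
    have "tl \<in> lmod_hom D (univ_sum N' C) G"
      using NG by (intro lmod_homI) (auto simp: univ_sum_def N'_def)
    moreover have "(\<lambda>c. Inr c # \<zero>\<^bsub>G\<^esub>) \<in> lmod_hom D C (univ_sum N' C)"
      using N0 by (intro lmod_homI) (auto simp: univ_sum_def N'_def G.smult_r_null)
    moreover have "tl ` carrier (univ_sum N' C) = N"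
      using C.M.zero_closed by (force simp: univ_sum_def N'_def image_iff)
    moreover have "(\<lambda>c. Inr c # \<zero>\<^bsub>G\<^esub>) ` carrier C = a_kernel (univ_sum N' C) G tl"
      using N0 by (auto simp: univ_sum_def N'_def a_kernel_def')
    moreover have "inj_on (\<lambda>c. Inr c # \<zero>\<^bsub>G\<^esub>) (carrier C)"
      by (auto simp: inj_on_def)
    ultimately show ?thesis
      using p G A.left_module_axioms C.left_module_axioms left_module_univ_sum[OF N' C.left_module_axioms]
      by (simp add: ext2_seqs_def Z_def)
  qed
  have triv: "trivial_ext2 A C \<in> ext2_seqs D A C"
    by (intro trivial_ext2_in_seqs A.left_module_axioms C.left_module_axioms)
  have spl: "yoneda_splice X Y \<in> ext2_seqs D A C" by (rule yoneda_splice_in_seqs[OF X Y])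
  have "(Z, trivial_ext2 A C) \<in> ext2_mor D A C"
  proof -
    have "(\<lambda>x. to_univ (p x)) \<in> lmod_hom D G (univ_copy A)"
      using lmod_homD[OF p(1)] by (intro lmod_homI) (auto simp: univ_copy_def)
    \<comment> \<open>\<open>of_univ\<close> reads only the first letter, so this is (n, c) to c,
      landing in the copy of C used by \<open>trivial_ext2\<close>.\<close>
    moreover have "(\<lambda>u. to_univ (of_univ u)) \<in> lmod_hom D (univ_sum N' C) (univ_copy C)"
      by (intro lmod_homI) (auto simp: univ_copy_def univ_sum_def)
    \<comment> \<open>The differential of the trivial sequence is zero, so the square commutes
      because p kills N.\<close>
    moreover have "p (tl u) = \<zero>\<^bsub>A\<^esub>" if "u \<in> carrier (univ_sum N' C)" for u
      using that p(3) by (auto simp: univ_sum_def N'_def a_kernel_def')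
    ultimately show ?thesis
      using Z triv unfolding ext2_mor_def
      by (simp add: Z_def trivial_ext2_def,
          intro bexI[of _ "\<lambda>x. to_univ (p x)"] conjI bexI[of _ "\<lambda>u. to_univ (of_univ u)"])
        (simp_all add: univ_copy_def)
  qed
  moreover have "(Z, yoneda_splice X Y) \<in> ext2_mor D A C"
  proof -
    \<comment> \<open>(n, c) goes to g n + c, with c embedded by \<open>inc Y\<close>. The second
      summand dies under \<open>prj Y\<close>, so the square reduces to the hypothesis relating g
      and f on N.\<close>
    define k where "k u = g (tl u) \<oplus>\<^bsub>mid Y\<^esub> inc Y (of_univ u)" for u
    have i: "inc Y \<in> lmod_hom D C (mid Y)" and pr: "prj Y \<in> lmod_hom D (mid Y) B"
      using seY by (auto simp: short_exact_def)
    have pri: "prj Y (inc Y c) = \<zero>\<^bsub>B\<^esub>" if "c \<in> carrier C" for c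
      using seY that by (auto simp: short_exact_def a_kernel_def')
    note gD = lmod_homD[OF g(1)[folded N'_def]]
    have g0: "g \<zero>\<^bsub>G\<^esub> = \<zero>\<^bsub>mid Y\<^esub>"
      using lmod_hom_zero[OF N' Y.left_module_axioms g(1)[folded N'_def]] by (simp add: N'_def)
    have "k \<in> lmod_hom D (univ_sum N' C) (mid Y)"
      using gD lmod_homD[OF i]
      by (intro lmod_homI) (auto simp: k_def univ_sum_def Y.smult_r_distr Y.a_ac)
    moreover have "inc X (prj Y (k u)) = f (tl u)" if "u \<in> carrier (univ_sum N' C)" for u
    proof -
      obtain n c where u: "u = Inr c # n" "n \<in> carrier N'" "c \<in> carrier C"
        using \<open>u \<in> _\<close> by (auto simp: univ_sum_def)
      then have "prj Y (k u) = prj Y (g n)"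
        using lmod_homD[OF pr] gD lmod_homD[OF i] pri by (simp add: k_def)
      then show ?thesis using u g(2) by (simp add: N'_def)
    qed
    moreover have "k (Inr c # \<zero>\<^bsub>G\<^esub>) = inc Y c" if "c \<in> carrier C" for c
      using lmod_homD(1)[OF i that] by (simp add: k_def g0)
    ultimately show ?thesis
      using Z spl f unfolding ext2_mor_def
      by (simp add: Z_def yoneda_splice_def, intro bexI[of _ f] conjI bexI[of _ k]) simp_all
  qed
  \<comment> \<open>Both morphisms start at \<open>Z\<close>; the path from the splice to the
    trivial sequence runs backwards along one and forwards along the other.\<close>
  ultimately show ?thesis
    using spl triv unfolding ext2_rel_def
    by (auto intro: rtrancl_trans[of _ Z])
qed

text \<open>The filtration supplies the data for \<open>splice_rel_trivial\<close>: p is the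
  quotient map E_a to E_a / E_{a+1} followed by the identification with L_a, while f and g arise
  from one construction at the indices a and a + 1.\<close>

lemma yoneda_prod_filtration_eq_zero:
  fixes W :: "('r, 'm, ('r, 'm) univ) ext_module"
  assumes \<eta>: "\<And>i. i < c \<Longrightarrow> \<eta> i \<in> Ext1 D (L i) (L (Suc i))"
    and W: "W \<in> ExtMod_data D c L \<eta>" and a: "Suc a < c"
  shows "yoneda_prod D (L a) (L (Suc (Suc a))) (\<eta> a) (\<eta> (Suc a))
    = Ext2_zero D (L a) (L (Suc (Suc a)))"
proof -
  define E where "E = emod W"
  define F where "F = chain W"
  define \<phi> where "\<phi> = ident W"
  have E: "left_module D E"
    and sub: "\<And>i. i \<le> Suc c \<Longrightarrow> submodule (F i) D E"
    and step: "\<And>i. i \<le> c \<Longrightarrow> F (Suc i) \<subseteq> F i"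
    using W by (auto simp: ExtMod_data_def c_extension_module_def E_def F_def)
  have \<phi>: "\<phi> i \<in> lmod_iso D (lmod_quot (E\<lparr>carrier := F i\<rparr>) (F (Suc i))) (L i)" if "i \<le> c" for i
    using W that by (auto simp: ExtMod_data_def subfactor_def E_def F_def \<phi>_def)
  have rep: "represents D (L i) (L (Suc i)) (subfactor_seq W i) (\<eta> i)" if "i < c" for i
    using W that by (auto simp: ExtMod_data_def)
  have Ei: "left_module D (E\<lparr>carrier := F i\<rparr>)" if "i \<le> c" for i
    using left_module_restrict[OF E sub] that by simp
  have FE: "F i \<subseteq> carrier E" if "i \<le> c" for i
    using subgroup.subset[OF submodule.axioms(1)[OF sub]] that by auto
  have subi: "submodule (F j) D (E\<lparr>carrier := F i\<rparr>)" if "j \<le> Suc c" "i \<le> c" "F j \<subseteq> F i" for i j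
    using submodule_restrict[OF E sub sub] that by simp
  have two: "F (Suc (Suc i)) \<subseteq> F i" if "i < c" for i
    using step[of i] step[of "Suc i"] that by auto
  \<comment> \<open>The middle term of \<open>subfactor_seq\<close> consists of cosets, outside the
    universe, so a congruent X in the class \<open>\<eta> i\<close> replaces it. The projection
    formula at i = a + 1 and the inclusion formula at i = a share the term
    \<open>\<phi> (Suc a)\<close> of the coset of n; together they give the compatibility of g with
    f.\<close>
  have ext: "\<exists>X\<in>\<eta> i. X \<in> ext1_seqs D (L i) (L (Suc i)) \<and>
      (\<exists>f\<in>lmod_hom D (E\<lparr>carrier := F i\<rparr>) (mid X).
        (\<forall>x\<in>F i. prj X (f x) = \<phi> i (F (Suc i) +>\<^bsub>E\<^esub> x)) \<and>
        (\<forall>n\<in>F (Suc i). inc X (\<phi> (Suc i) (F (Suc (Suc i)) +>\<^bsub>E\<^esub> n)) = f n))" if i: "i < c" for i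
  proof -
    let ?S = "subfactor_seq W i"
    obtain X h where X: "X \<in> \<eta> i" and h: "h \<in> lmod_iso D (mid ?S) (mid X)"
      and hi: "\<And>b. b \<in> carrier (L (Suc i)) \<Longrightarrow> h (inc ?S b) = inc X b"
      and hp: "\<And>s. s \<in> carrier (mid ?S) \<Longrightarrow> prj X (h s) = prj ?S s"
      using rep[OF i] unfolding represents_def congruent_ext1_def by blast
    have "X \<in> ext1_seqs D (L i) (L (Suc i))"
      using \<eta>[OF i] X in_quotient_imp_subset[OF equiv_ext1_rel] unfolding Ext1_def by blast
    moreover
    \<comment> \<open>The quotient map E_i to E_i / E_{i+2}, followed by the congruence h.\<close>
    define f where "f x = h (F (Suc (Suc i)) +>\<^bsub>E\<^esub> x)" for x
    have mid: "mid ?S = lmod_quot (E\<lparr>carrier := F i\<rparr>) (F (Suc (Suc i)))"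
      by (simp add: subfactor_seq_def subfactor_def E_def F_def)
    have q: "a_r_coset E (F (Suc (Suc i))) \<in> lmod_hom D (E\<lparr>carrier := F i\<rparr>) (mid ?S)"
      using quot_proj(1)[OF Ei subi[of "Suc (Suc i)" i]] two[OF i] i by (simp add: mid)
    have "f \<in> lmod_hom D (E\<lparr>carrier := F i\<rparr>) (mid X)"
      using lmod_hom_comp[OF q] h unfolding f_def lmod_iso_def by blast
    moreover have "prj X (f x) = \<phi> i (F (Suc i) +>\<^bsub>E\<^esub> x)" if x: "x \<in> F i" for x
    proof -
      have "prj X (f x) = prj ?S (F (Suc (Suc i)) +>\<^bsub>E\<^esub> x)"
        unfolding f_def using hp lmod_homD(1)[OF q] x by simp
      also have "\<dots> = \<phi> i (F (Suc i) <+>\<^bsub>E\<^esub> (F (Suc (Suc i)) +>\<^bsub>E\<^esub> x))"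
        by (simp add: subfactor_seq_def E_def F_def \<phi>_def)
      also have "F (Suc i) <+>\<^bsub>E\<^esub> (F (Suc (Suc i)) +>\<^bsub>E\<^esub> x) = F (Suc i) +>\<^bsub>E\<^esub> x"
        using set_add_a_r_coset[OF E sub sub step] FE[of i] x i by auto
      finally show ?thesis .
    qed
    moreover have "inc X (\<phi> (Suc i) (F (Suc (Suc i)) +>\<^bsub>E\<^esub> n)) = f n" if n: "n \<in> F (Suc i)" for n
    proof -
      let ?Q = "lmod_quot (E\<lparr>carrier := F (Suc i)\<rparr>) (F (Suc (Suc i)))"
      have iso: "bij_betw (\<phi> (Suc i)) (carrier ?Q) (carrier (L (Suc i)))"
        using \<phi>[of "Suc i"] i by (simp add: lmod_iso_def)
      have m: "F (Suc (Suc i)) +>\<^bsub>E\<^esub> n \<in> carrier ?Q"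
        using lmod_homD(1)[OF quot_proj(1)[OF Ei subi[of "Suc (Suc i)" "Suc i"]]] step[of "Suc i"] i n
        by simp
      \<comment> \<open>The inclusion inverts the identification, so it returns the coset of n
        itself, now read as an element of E_i / E_{i+2}.\<close>
      have "inc ?S = inv_into (carrier ?Q) (\<phi> (Suc i))"
        by (simp add: subfactor_seq_def subfactor_def E_def F_def \<phi>_def)
      then have "inc ?S (\<phi> (Suc i) (F (Suc (Suc i)) +>\<^bsub>E\<^esub> n)) = F (Suc (Suc i)) +>\<^bsub>E\<^esub> n"
        using iso m by (simp add: bij_betw_def)
      moreover have "\<phi> (Suc i) (F (Suc (Suc i)) +>\<^bsub>E\<^esub> n) \<in> carrier (L (Suc i))"
        using iso m by (rule bij_betw_apply)
      ultimately show ?thesis unfolding f_def by (metis hi)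
    qed
    ultimately show ?thesis using X by (intro bexI[of _ X] conjI bexI[of _ f] ballI)
  qed
  obtain X f where X: "X \<in> \<eta> a" "X \<in> ext1_seqs D (L a) (L (Suc a))"
    and f: "f \<in> lmod_hom D (E\<lparr>carrier := F a\<rparr>) (mid X)"
      "\<And>x. x \<in> F a \<Longrightarrow> prj X (f x) = \<phi> a (F (Suc a) +>\<^bsub>E\<^esub> x)"
      "\<And>n. n \<in> F (Suc a) \<Longrightarrow> inc X (\<phi> (Suc a) (F (Suc (Suc a)) +>\<^bsub>E\<^esub> n)) = f n"
    using ext[of a] a by auto
  obtain Y g where Y: "Y \<in> \<eta> (Suc a)" "Y \<in> ext1_seqs D (L (Suc a)) (L (Suc (Suc a)))"
    and g: "g \<in> lmod_hom D (E\<lparr>carrier := F (Suc a)\<rparr>) (mid Y)"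
      "\<And>x. x \<in> F (Suc a) \<Longrightarrow> prj Y (g x) = \<phi> (Suc a) (F (Suc (Suc a)) +>\<^bsub>E\<^esub> x)"
    using ext[of "Suc a"] a by auto
  define p where "p x = \<phi> a (F (Suc a) +>\<^bsub>E\<^esub> x)" for x
  let ?G = "E\<lparr>carrier := F a\<rparr>" and ?Q = "lmod_quot (E\<lparr>carrier := F a\<rparr>) (F (Suc a))"
  have G: "left_module D ?G" and N: "submodule (F (Suc a)) D ?G"
    using Ei[of a] subi[of "Suc a" a] step[of a] a by auto
  note q = quot_proj[OF G N, unfolded a_r_coset_restrict]
  have bij: "bij_betw (\<phi> a) (carrier ?Q) (carrier (L a))" and hom: "\<phi> a \<in> lmod_hom D ?Q (L a)"
    using \<phi>[of a] a by (auto simp: lmod_iso_def)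
  have p: "p \<in> lmod_hom D ?G (L a)"
    unfolding p_def by (rule lmod_hom_comp[OF q(1) hom])
  have im: "p ` carrier ?G = carrier (L a)"
    using bij q(2) unfolding p_def bij_betw_def by (metis image_image)
  have La: "left_module D (L a)" using X(2) by (simp add: ext1_seqs_def short_exact_def)
  interpret G: left_module D ?G by (rule G)
  have p0: "p \<zero>\<^bsub>E\<^esub> = \<zero>\<^bsub>L a\<^esub>"
    using lmod_hom_zero[OF G La p] by simp
  have z: "\<zero>\<^bsub>E\<^esub> \<in> F a" "\<zero>\<^bsub>E\<^esub> \<in> F (Suc a)"
    using G.M.zero_closed subgroup.one_closed[OF submodule.axioms(1)[OF N]] by simp_all
  \<comment> \<open>The kernel of p is E_{a+1}: by injectivity of \<open>\<phi> a\<close>, p x = p 0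
    means that x and 0 have the same coset.\<close>
  have "p x = \<zero>\<^bsub>L a\<^esub> \<longleftrightarrow> x \<in> F (Suc a)" if x: "x \<in> F a" for x
  proof -
    have "p x = \<zero>\<^bsub>L a\<^esub> \<longleftrightarrow> F (Suc a) +>\<^bsub>E\<^esub> x = F (Suc a) +>\<^bsub>E\<^esub> \<zero>\<^bsub>E\<^esub>"
      unfolding p0[symmetric] p_def
      using bij x z lmod_homD(1)[OF q(1)] by (intro inj_on_eq_iff) (auto simp: bij_betw_def)
    also have "\<dots> \<longleftrightarrow> x \<in> F (Suc a)" using q(3)[of x] q(3)[of "\<zero>\<^bsub>E\<^esub>"] x z by simp
    finally show ?thesis .
  qed
  then have ker: "a_kernel ?G (L a) p = F (Suc a)"
    using step[of a] a by (auto simp: a_kernel_def')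
  have "(yoneda_splice X Y, trivial_ext2 (L a) (L (Suc (Suc a)))) \<in> ext2_rel D (L a) (L (Suc (Suc a)))"
    by (rule splice_rel_trivial[OF X(2) Y(2) G N p im ker f(1) _ _, where g = g])
      (use f g in \<open>auto simp: p_def\<close>)
  then have "ext2_rel D (L a) (L (Suc (Suc a))) `` {yoneda_splice X Y} = Ext2_zero D (L a) (L (Suc (Suc a)))"
    unfolding Ext2_zero_def by (rule equiv_class_eq[OF equiv_ext2_rel])
  \<comment> \<open>\<open>yoneda_prod_eq\<close> allows the product to be computed from the chosen
    X and Y.\<close>
  then show ?thesis
    using yoneda_prod_eq[OF \<eta> \<eta> X(1) Y(1)] a by simp
qed

theorem corollary6p1:
  fixes D :: "('r, 'x) ring_scheme"
    and c :: nat
    and L :: "nat \<Rightarrow> ('r, 'm) module"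
    and \<eta> :: "nat \<Rightarrow> ('r, 'm, ('r, 'm) univ) ext1 set"
  assumes "ring D"
    and "c \<ge> 3"
    and "\<And>i. i \<le> c \<Longrightarrow> left_module D (L i)"
    and "\<And>i. i < c \<Longrightarrow> \<eta> i \<in> Ext1 D (L i) (L (i + 1))"
    and "ExtMod D c L \<eta> \<noteq> {}"
  shows "\<forall>i \<in> {1..c - 1}.
    yoneda_prod D (L (i - 1)) (L (i + 1)) (\<eta> (i - 1)) (\<eta> i) = Ext2_zero D (L (i - 1)) (L (i + 1))"
proof
  fix i assume i: "i \<in> {1..c - 1}"
  \<comment> \<open>With a = i - 1 the bound i < c reads a + 1 < c, so the chain reaches E_{a+3}, as
    the second sequence requires.\<close>
  then obtain a where a: "i = Suc a" "Suc a < c"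
    using assms(2) by (cases i) auto
  \<comment> \<open>A nonempty set of classes comes from a nonempty set of data; any W will
    do.\<close>
  obtain W where "W \<in> ExtMod_data D c L \<eta>"
    using assms(5) by (auto simp: ExtMod_def quotient_def)
  then show "yoneda_prod D (L (i - 1)) (L (i + 1)) (\<eta> (i - 1)) (\<eta> i) =
      Ext2_zero D (L (i - 1)) (L (i + 1))"
    using yoneda_prod_filtration_eq_zero[of c \<eta> D L W a] assms(4) a by simp
qed

end
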